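(* Let $\mathcal X$ and $\mathcal Y$ be infinite-dimensional separable real Hilbert spaces, let $T:\mathcal X\to\mathcal Y$ be an injective compact linear operator with singular values $\sigma_1\ge\sigma_2\ge\dots>0$, and let $\Phi(\epsilon)=\#\{n\in\mathbb N:\ \sigma_n^2>\epsilon\}$ for $\epsilon>0$ be its counting function. Then the interval of ill-posedness $[A_\sigma,B_\sigma]$ of the operator equation $Tu=g$ satisfies $$[A_\sigma,B_\sigma]=\left[\liminf_{\epsilon\searrow0}\frac{\log(\epsilon)}{-2\log(\Phi(\epsilon))},\ \limsup_{\epsilon\searrow0}\frac{\log(\epsilon)}{-2\log(\Phi(\epsilon))}\right],$$ i.e. the left endpoints agree and the right endpoints agree, as elements of $[0,\infty]$.
   Context: Singular values are listed in non-increasing order with multiplicity: there is a singular system $\{(u_n,v_n,\sigma_n)\}_{n\in\mathbb N}$ with $\{u_n\}$ a complete orthonormal system of $\mathcal X$, $\{v_n\}$ a complete orthonormal system of the closure of the range of $T$, and $Tu_n=\sigma_nv_n$, $T^*v_n=\sigma_nu_n$. The interval of ill-posedness of $Tu=g$ is defined by $$[A_\sigma,B_\sigma]:=\left[\liminf_{n\to\infty}\frac{-\log(\sigma_n)}{\log(n)},\ \limsup_{n\to\infty}\frac{-\log(\sigma_n)}{\log(n)}\right]\subset[0,\infty],$$ where endpoints equal to $\infty$ are allowed. *)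

theory Defs
  imports "HOL-Analysis.Analysis"
begin

text \<open>
  Real Hilbert spaces are types of sort \<open>{real_inner, complete_space}\<close>.
  Sequences written with subscripts starting at 1 are functions on \<^typ>\<open>nat\<close> of which
  only the values at indices \<open>n \<ge> 1\<close> are constrained or used (limits inferior and superior
  along \<^const>\<open>sequentially\<close> do not depend on finitely many terms).
\<close>

definition infinite_dimensional :: "'a::real_vector itself \<Rightarrow> bool" where
  "infinite_dimensional _ \<longleftrightarrow> \<not> (\<exists>B::'a set. finite B \<and> span B = UNIV)"

definition compact_operator :: "('a::real_normed_vector \<Rightarrow> 'b::real_normed_vector) \<Rightarrow> bool" where
  "compact_operator T \<longleftrightarrow> linear T \<and> (\<forall>S. bounded S \<longrightarrow> compact (closure (T ` S)))"

definition complete_orthonormal_system :: "(nat \<Rightarrow> 'a::real_inner) \<Rightarrow> 'a set \<Rightarrow> bool" where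
  "complete_orthonormal_system e S \<longleftrightarrow>
     (\<forall>m\<ge>1. \<forall>n\<ge>1. e m \<bullet> e n = (if m = n then 1 else 0)) \<and>
     closure (span (e ` {1..})) = S"

text \<open>
  Singular systems of an injective operator with infinite-dimensional domain: all singular
  values are positive, and they are listed in non-increasing order with multiplicity.
\<close>

definition singular_system ::
    "('a::real_inner \<Rightarrow> 'b::real_inner) \<Rightarrow> (nat \<Rightarrow> 'a) \<Rightarrow> (nat \<Rightarrow> 'b) \<Rightarrow> (nat \<Rightarrow> real) \<Rightarrow> bool" where
  "singular_system T u v \<sigma> \<longleftrightarrow>
     complete_orthonormal_system u UNIV \<and>
     complete_orthonormal_system v (closure (range T)) \<and>
     (\<forall>n\<ge>1. T (u n) = \<sigma> n *\<^sub>R v n \<and> adjoint T (v n) = \<sigma> n *\<^sub>R u n) \<and>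
     (\<forall>n\<ge>1. \<sigma> n > 0) \<and>
     (\<forall>m n. 1 \<le> m \<and> m \<le> n \<longrightarrow> \<sigma> n \<le> \<sigma> m)"

definition singular_values :: "('a::real_inner \<Rightarrow> 'b::real_inner) \<Rightarrow> (nat \<Rightarrow> real) \<Rightarrow> bool" where
  "singular_values T \<sigma> \<longleftrightarrow> (\<exists>u v. singular_system T u v \<sigma>)"

definition illposedness_lower :: "(nat \<Rightarrow> real) \<Rightarrow> ereal" where
  "illposedness_lower \<sigma> = liminf (\<lambda>n. ereal (- ln (\<sigma> n) / ln (real n)))"

definition illposedness_upper :: "(nat \<Rightarrow> real) \<Rightarrow> ereal" where
  "illposedness_upper \<sigma> = limsup (\<lambda>n. ereal (- ln (\<sigma> n) / ln (real n)))"

definition illposedness_interval :: "(nat \<Rightarrow> real) \<Rightarrow> ereal set" where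
  "illposedness_interval \<sigma> = {illposedness_lower \<sigma>..illposedness_upper \<sigma>}"

text \<open>
  For the singular values of a compact operator the set below is finite whenever
  \<open>\<epsilon> > 0\<close>, so \<^const>\<open>card\<close> is the number of its elements.
\<close>

definition counting_function :: "(nat \<Rightarrow> real) \<Rightarrow> real \<Rightarrow> nat" where
  "counting_function \<sigma> \<epsilon> = card {n. 1 \<le> n \<and> (\<sigma> n)\<^sup>2 > \<epsilon>}"

end

theory Submission
  imports Defs "HOL-Real_Asymp.Real_Asymp"
begin

text \<open>
  Compactness forces \<open>\<sigma> n \<longlonglongrightarrow> 0\<close>, and monotonicity gives
  \<open>n \<le> \<Phi> \<epsilon> \<longleftrightarrow> \<epsilon> < (\<sigma> n)\<^sup>2\<close>, so that \<open>(\<sigma> (\<Phi> \<epsilon> + 1))\<^sup>2 \<le> \<epsilon> < (\<sigma> (\<Phi> \<epsilon>))\<^sup>2\<close>.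
  Write \<open>a n = - ln (\<sigma> n) / ln n\<close> and let \<open>f \<epsilon>\<close> be the quotient formed with \<open>\<Phi>\<close>. The sandwich reads
  \<open>a (\<Phi> \<epsilon>) \<le> f \<epsilon> \<le> a (\<Phi> \<epsilon> + 1) * (ln (\<Phi> \<epsilon> + 1) / ln (\<Phi> \<epsilon>))\<close>, which bounds the limit inferior of
  \<open>f\<close> from below and its limit superior from above. The opposite bounds come from the
  test points \<open>\<epsilon> = (\<sigma> n)\<^sup>2 * exp (- 2)\<close>, where \<open>\<Phi> \<epsilon> \<ge> n\<close>, and \<open>\<epsilon> = (\<sigma> n)\<^sup>2\<close>, where \<open>\<Phi> \<epsilon> < n\<close>.
\<close>

section \<open>Limits inferior and superior under substitution\<close>

lemma Liminf_filterlim_le: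
  fixes f :: "'b \<Rightarrow> 'c::complete_linorder"
  assumes "filterlim h G F"
  shows "Liminf G f \<le> Liminf F (\<lambda>x. f (h x))"
proof -
  \<comment> \<open>By \<open>filterlim h G F\<close> every predicate eventually true for
    \<open>G\<close> is eventually true for \<open>filtermap h F\<close>, so the supremum defining
    \<open>Liminf\<close> runs over a larger set.\<close>
  have "Liminf G f \<le> Liminf (filtermap h F) f"
    using assms unfolding Liminf_def filterlim_def le_filter_def by (intro SUP_subset_mono) auto
  also have "\<dots> \<le> Liminf F (\<lambda>x. f (h x))"
    by (rule Liminf_filtermap_le)
  finally show ?thesis .
qed

lemma Limsup_filterlim_ge:
  fixes f :: "'b \<Rightarrow> 'c::complete_linorder"
  assumes "filterlim h G F"
  shows "Limsup F (\<lambda>x. f (h x)) \<le> Limsup G f"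
proof -
  have "Limsup F (\<lambda>x. f (h x)) \<le> Limsup (filtermap h F) f"
    by (rule Limsup_filtermap_ge)
  also have "\<dots> \<le> Limsup G f"
    using assms unfolding Limsup_def filterlim_def le_filter_def by (intro INF_superset_mono) auto
  finally show ?thesis .
qed

section \<open>Decreasing null sequences and their counting function\<close>

locale decreasing_null_sequence =
  fixes \<sigma> :: "nat \<Rightarrow> real"
  assumes pos: "1 \<le> n \<Longrightarrow> 0 < \<sigma> n"
    and decreasing: "1 \<le> m \<Longrightarrow> m \<le> n \<Longrightarrow> \<sigma> n \<le> \<sigma> m"
    and tendsto_0: "\<sigma> \<longlonglongrightarrow> 0"
begin

text \<open>Monotonicity makes the counted set an initial segment of the positive integers, so its
  cardinality tells which indices it contains.\<close>

lemma counting_function_ge_iff: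
  assumes "0 < \<epsilon>" "1 \<le> n"
  shows "n \<le> counting_function \<sigma> \<epsilon> \<longleftrightarrow> \<epsilon> < (\<sigma> n)\<^sup>2"
proof -
  have below: "{k. 1 \<le> k \<and> \<epsilon> < (\<sigma> k)\<^sup>2} \<subseteq> {1..<m}" if "1 \<le> m" "(\<sigma> m)\<^sup>2 \<le> \<epsilon>" for m
  proof
    fix k assume k: "k \<in> {k. 1 \<le> k \<and> \<epsilon> < (\<sigma> k)\<^sup>2}"
    have "k < m"
    proof (rule ccontr)
      assume "\<not> k < m"
      then have "(\<sigma> k)\<^sup>2 \<le> (\<sigma> m)\<^sup>2"
        using that k pos[of k] decreasing[of m k] by (intro power_mono) auto
      with k that show False by simp
    qed
    with k show "k \<in> {1..<m}" by simp
  qed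
  \<comment> \<open>Finiteness has to come from convergence to 0: an infinite counted set would have
    \<open>card\<close> equal to 0, and the backward direction would fail.\<close>
  have "(\<lambda>n. (\<sigma> n)\<^sup>2) \<longlonglongrightarrow> 0"
    using tendsto_power[OF tendsto_0, of 2] by simp
  then have "\<forall>\<^sub>F n in sequentially. (\<sigma> n)\<^sup>2 < \<epsilon>"
    using \<open>0 < \<epsilon>\<close> by (rule order_tendstoD)
  then have "\<forall>\<^sub>F m in sequentially. 1 \<le> m \<and> (\<sigma> m)\<^sup>2 < \<epsilon>"
    using eventually_ge_at_top by (rule eventually_conj[rotated])
  then obtain m where "1 \<le> m" "(\<sigma> m)\<^sup>2 < \<epsilon>"
    using eventually_happens by fastforce
  then have fin: "finite {k. 1 \<le> k \<and> \<epsilon> < (\<sigma> k)\<^sup>2}"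
    using finite_subset[OF below[of m]] by simp
  show ?thesis
  proof
    assume le: "n \<le> counting_function \<sigma> \<epsilon>"
    show "\<epsilon> < (\<sigma> n)\<^sup>2"
    proof (rule ccontr)
      assume "\<not> \<epsilon> < (\<sigma> n)\<^sup>2"
      then have "counting_function \<sigma> \<epsilon> \<le> card {1..<n}"
        unfolding counting_function_def using below[of n] \<open>1 \<le> n\<close> by (intro card_mono) auto
      with le \<open>1 \<le> n\<close> show False by simp
    qed
  next
    assume less: "\<epsilon> < (\<sigma> n)\<^sup>2"
    have "{1..n} \<subseteq> {k. 1 \<le> k \<and> \<epsilon> < (\<sigma> k)\<^sup>2}"
    proof
      fix k assume k: "k \<in> {1..n}"
      then have "(\<sigma> n)\<^sup>2 \<le> (\<sigma> k)\<^sup>2"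
        using \<open>1 \<le> n\<close> pos[of n] decreasing[of k n] by (intro power_mono) auto
      with k less show "k \<in> {k. 1 \<le> k \<and> \<epsilon> < (\<sigma> k)\<^sup>2}" by simp
    qed
    from card_mono[OF fin this] show "n \<le> counting_function \<sigma> \<epsilon>"
      by (simp add: counting_function_def)
  qed
qed

lemma counting_function_at_top: "filterlim (counting_function \<sigma>) at_top (at_right 0)"
proof (subst filterlim_at_top_ge[where c = 1], intro allI impI)
  fix n :: nat assume n: "1 \<le> n"
  have "\<forall>\<^sub>F \<epsilon> in at_right 0. \<epsilon> \<in> {0<..<(\<sigma> n)\<^sup>2}"
    using pos[OF n] by (intro eventually_at_right_real) simp
  then show "\<forall>\<^sub>F \<epsilon> in at_right 0. n \<le> counting_function \<sigma> \<epsilon>"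
    by eventually_elim (use counting_function_ge_iff[OF _ n] in auto)
qed

text \<open>The factor \<open>c\<close> covers both families of test points:
  \<open>exp (- 2)\<close> for the lower endpoint and 1 for the upper one.\<close>

lemma filterlim_cmult_square_at_right_0:
  assumes "0 < c"
  shows "filterlim (\<lambda>n. (\<sigma> n)\<^sup>2 * c) (at_right 0) sequentially"
proof -
  have "(\<lambda>n. (\<sigma> n)\<^sup>2 * c) \<longlonglongrightarrow> 0"
    using tendsto_mult[OF tendsto_power[OF tendsto_0, of 2] tendsto_const[of c]] by simp
  moreover have "\<forall>\<^sub>F n in sequentially. 0 < (\<sigma> n)\<^sup>2 * c"
    using eventually_ge_at_top[of 1]
  proof eventually_elim
    case (elim n)
    then show ?case using pos[of n] assms by simp
  qed
  ultimately show ?thesis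
    by (rule tendsto_imp_filterlim_at_right)
qed

section \<open>The four inequalities between the endpoints\<close>

lemma illposedness_lower_le:
  "illposedness_lower \<sigma> \<le>
    Liminf (at_right 0) (\<lambda>\<epsilon>. ereal (ln \<epsilon> / (- 2 * ln (real (counting_function \<sigma> \<epsilon>)))))"
proof -
  let ?a = "\<lambda>n. ereal (- ln (\<sigma> n) / ln (real n))"
  have "illposedness_lower \<sigma> \<le> Liminf (at_right 0) (\<lambda>\<epsilon>. ?a (counting_function \<sigma> \<epsilon>))"
    unfolding illposedness_lower_def
    by (rule Liminf_filterlim_le[where f = ?a, OF counting_function_at_top])
  also have "\<dots> \<le> Liminf (at_right 0)
      (\<lambda>\<epsilon>. ereal (ln \<epsilon> / (- 2 * ln (real (counting_function \<sigma> \<epsilon>)))))"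
  proof (rule Liminf_mono)
    \<comment> \<open>A count of at least 2 has a positive logarithm, so division by it preserves
      inequalities.\<close>
    have "\<forall>\<^sub>F \<epsilon> in at_right 0. 2 \<le> counting_function \<sigma> \<epsilon>"
      using counting_function_at_top by (simp add: filterlim_at_top)
    then show "\<forall>\<^sub>F \<epsilon> in at_right 0. ?a (counting_function \<sigma> \<epsilon>)
        \<le> ereal (ln \<epsilon> / (- 2 * ln (real (counting_function \<sigma> \<epsilon>))))"
      using eventually_at_right_less[of 0]
    proof eventually_elim
      case (elim \<epsilon>)
      define n where "n = counting_function \<sigma> \<epsilon>"
      have n: "2 \<le> n" "0 < \<sigma> n" "\<epsilon> < (\<sigma> n)\<^sup>2"
        using elim pos[of n] counting_function_ge_iff[of \<epsilon> n] by (auto simp: n_def)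
      have "ln \<epsilon> < ln ((\<sigma> n)\<^sup>2)"
        using n elim by (subst ln_less_cancel_iff) auto
      then have "ln \<epsilon> \<le> 2 * ln (\<sigma> n)"
        using n by (simp add: ln_realpow)
      moreover have "0 < ln (real n)"
        using n by simp
      ultimately have "- ln (\<sigma> n) / ln (real n) \<le> ln \<epsilon> / (- 2 * ln (real n))"
        by (simp add: field_simps)
      then show ?case
        by (simp add: n_def)
    qed
  qed
  finally show ?thesis .
qed

text \<open>The index \<open>Suc n\<close> after the count \<open>n\<close> is the first one not
  counted, which bounds \<epsilon> from below. The resulting quotient mixes \<open>Suc n\<close> in
  the numerator with \<open>n\<close> in the denominator; the factor \<open>?r\<close>, which tends
  to 1, repairs the mismatch.\<close>

lemma illposedness_upper_ge:
  "Limsup (at_right 0) (\<lambda>\<epsilon>. ereal (ln \<epsilon> / (- 2 * ln (real (counting_function \<sigma> \<epsilon>)))))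
    \<le> illposedness_upper \<sigma>"
proof -
  let ?a = "\<lambda>n. ereal (- ln (\<sigma> n) / ln (real n))"
  let ?r = "\<lambda>n. ereal (ln (real (Suc n)) / ln (real n))"
  have "Limsup (at_right 0) (\<lambda>\<epsilon>. ereal (ln \<epsilon> / (- 2 * ln (real (counting_function \<sigma> \<epsilon>)))))
      \<le> Limsup (at_right 0)
          (\<lambda>\<epsilon>. ?r (counting_function \<sigma> \<epsilon>) * ?a (Suc (counting_function \<sigma> \<epsilon>)))"
  proof (rule Limsup_mono)
    have "\<forall>\<^sub>F \<epsilon> in at_right 0. 2 \<le> counting_function \<sigma> \<epsilon>"
      using counting_function_at_top by (simp add: filterlim_at_top)
    then show "\<forall>\<^sub>F \<epsilon> in at_right 0. ereal (ln \<epsilon> / (- 2 * ln (real (counting_function \<sigma> \<epsilon>))))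
        \<le> ?r (counting_function \<sigma> \<epsilon>) * ?a (Suc (counting_function \<sigma> \<epsilon>))"
      using eventually_at_right_less[of 0]
    proof eventually_elim
      case (elim \<epsilon>)
      define n where "n = counting_function \<sigma> \<epsilon>"
      have n: "2 \<le> n" "0 < \<sigma> (Suc n)" "(\<sigma> (Suc n))\<^sup>2 \<le> \<epsilon>"
        using elim pos[of "Suc n"] counting_function_ge_iff[of \<epsilon> "Suc n"] by (auto simp: n_def)
      have "ln ((\<sigma> (Suc n))\<^sup>2) \<le> ln \<epsilon>"
        using n elim by (subst ln_le_cancel_iff) auto
      then have "2 * ln (\<sigma> (Suc n)) \<le> ln \<epsilon>"
        using n by (simp add: ln_realpow)
      moreover have ln_pos: "0 < ln (real n)" "0 < ln (real (Suc n))"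
        using n by simp_all
      ultimately have "ln \<epsilon> / (- 2 * ln (real n)) \<le> - ln (\<sigma> (Suc n)) / ln (real n)"
        by (simp add: field_simps)
      also have "\<dots> = ln (real (Suc n)) / ln (real n) * (- ln (\<sigma> (Suc n)) / ln (real (Suc n)))"
        using ln_pos by simp
      finally show ?case
        by (simp add: n_def)
    qed
  qed
  also have "\<dots> \<le> limsup (\<lambda>n. ?r n * ?a (Suc n))"
    by (rule Limsup_filterlim_ge[where f = "\<lambda>n. ?r n * ?a (Suc n)", OF counting_function_at_top])
  \<comment> \<open>The limit 1 is finite and nonzero, so it can be pulled out even if the remaining
    limit superior is infinite.\<close>
  also have "\<dots> = 1 * limsup (\<lambda>n. ?a (Suc n))"
  proof (rule ereal_limsup_lim_mult)
    have "(\<lambda>n. ln (real (Suc n)) / ln (real n)) \<longlonglongrightarrow> 1"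
      by real_asymp
    then show "?r \<longlonglongrightarrow> 1"
      by (simp add: one_ereal_def)
  qed auto
  also have "\<dots> \<le> illposedness_upper \<sigma>"
    unfolding illposedness_upper_def
    using Limsup_filterlim_ge[where f = ?a, OF filterlim_Suc] by simp
  finally show ?thesis .
qed

lemma illposedness_lower_ge:
  "Liminf (at_right 0) (\<lambda>\<epsilon>. ereal (ln \<epsilon> / (- 2 * ln (real (counting_function \<sigma> \<epsilon>)))))
    \<le> illposedness_lower \<sigma>"
proof -
  let ?f = "\<lambda>\<epsilon>. ereal (ln \<epsilon> / (- 2 * ln (real (counting_function \<sigma> \<epsilon>))))"
  \<comment> \<open>A factor below 1 makes the test point strictly smaller than the square of
    \<sigma> at \<open>n\<close>, so \<open>n\<close> itself is counted. The choice
    \<open>exp (- 2)\<close> shifts half the negative logarithm by exactly 1, an error that vanishes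
    after division by \<open>ln (real n)\<close>.\<close>
  let ?\<epsilon> = "\<lambda>n. (\<sigma> n)\<^sup>2 * exp (- 2)"
  have "Liminf (at_right 0) ?f \<le> liminf (\<lambda>n. ?f (?\<epsilon> n))"
    by (rule Liminf_filterlim_le[where f = ?f, OF filterlim_cmult_square_at_right_0]) simp
  also have "\<dots> \<le> liminf (\<lambda>n. ereal (1 / ln (real n)) + ereal (- ln (\<sigma> n) / ln (real n)))"
  proof (rule Liminf_mono)
    have "\<forall>\<^sub>F n in sequentially. \<sigma> n < 1"
      using tendsto_0 by (rule order_tendstoD) simp
    then show "\<forall>\<^sub>F n in sequentially.
        ?f (?\<epsilon> n) \<le> ereal (1 / ln (real n)) + ereal (- ln (\<sigma> n) / ln (real n))"
      using eventually_ge_at_top[of 2]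
    proof eventually_elim
      case (elim n)
      have \<sigma>: "0 < \<sigma> n" "\<sigma> n < 1"
        using elim pos[of n] by auto
      have "n \<le> counting_function \<sigma> (?\<epsilon> n)"
        using elim \<sigma> by (subst counting_function_ge_iff) auto
      then have ln_mono: "ln (real n) \<le> ln (real (counting_function \<sigma> (?\<epsilon> n)))"
        using elim by simp
      have ln_pos: "0 < ln (real n)"
        using elim by simp
      have "ln (?\<epsilon> n) / (- 2 * ln (real (counting_function \<sigma> (?\<epsilon> n))))
          = (1 - ln (\<sigma> n)) / ln (real (counting_function \<sigma> (?\<epsilon> n)))"
        using \<sigma> ln_pos ln_mono by (simp add: ln_mult ln_realpow field_simps)
      \<comment> \<open>Passing to the smaller denominator increases the quotient because the
        numerator is nonnegative; this is where \<open>\<sigma> n < 1\<close> enters.\<close>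
      also have "\<dots> \<le> (1 - ln (\<sigma> n)) / ln (real n)"
      proof (rule divide_left_mono)
        show "0 \<le> 1 - ln (\<sigma> n)"
          using ln_less_zero[OF \<sigma>] by linarith
      qed (use ln_pos ln_mono in auto)
      finally show ?case
        by (simp add: diff_divide_distrib)
    qed
  qed
  also have "\<dots> = 0 + liminf (\<lambda>n. ereal (- ln (\<sigma> n) / ln (real n)))"
  proof (rule ereal_liminf_lim_add)
    have "(\<lambda>n. 1 / ln (real n)) \<longlonglongrightarrow> 0"
      by real_asymp
    then show "(\<lambda>n. ereal (1 / ln (real n))) \<longlonglongrightarrow> 0"
      by (simp add: zero_ereal_def)
  qed auto
  finally show ?thesis
    by (simp add: illposedness_lower_def)
qed

lemma illposedness_upper_le:
  "illposedness_upper \<sigma> \<le>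
    Limsup (at_right 0) (\<lambda>\<epsilon>. ereal (ln \<epsilon> / (- 2 * ln (real (counting_function \<sigma> \<epsilon>)))))"
proof -
  let ?f = "\<lambda>\<epsilon>. ereal (ln \<epsilon> / (- 2 * ln (real (counting_function \<sigma> \<epsilon>))))"
  have lim: "filterlim (\<lambda>n. (\<sigma> n)\<^sup>2) (at_right 0) sequentially"
    using filterlim_cmult_square_at_right_0[of 1] by simp
  have "illposedness_upper \<sigma> \<le> limsup (\<lambda>n. ?f ((\<sigma> n)\<^sup>2))"
    unfolding illposedness_upper_def
  proof (rule Limsup_mono)
    have "\<forall>\<^sub>F n in sequentially. \<sigma> n < 1"
      using tendsto_0 by (rule order_tendstoD) simp
    \<comment> \<open>The count at the test point may be 0 or 1 for small \<open>n\<close>; its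
      logarithm is positive only eventually.\<close>
    moreover have "\<forall>\<^sub>F n in sequentially. 2 \<le> counting_function \<sigma> ((\<sigma> n)\<^sup>2)"
      using filterlim_compose[OF counting_function_at_top lim] by (simp add: filterlim_at_top)
    ultimately show "\<forall>\<^sub>F n in sequentially.
        ereal (- ln (\<sigma> n) / ln (real n)) \<le> ?f ((\<sigma> n)\<^sup>2)"
      using eventually_ge_at_top[of 2]
    proof eventually_elim
      case (elim n)
      have \<sigma>: "0 < \<sigma> n" "\<sigma> n < 1"
        using elim pos[of n] by auto
      \<comment> \<open>The strict inequality in the counting function excludes \<open>n\<close> and
        every index with the same singular value, so repeated values do no harm.\<close>
      have "counting_function \<sigma> ((\<sigma> n)\<^sup>2) < n"
        using elim \<sigma> counting_function_ge_iff[of "(\<sigma> n)\<^sup>2" n] by auto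
      then have ln_mono: "ln (real (counting_function \<sigma> ((\<sigma> n)\<^sup>2))) \<le> ln (real n)"
        using elim by simp
      have ln_pos: "0 < ln (real (counting_function \<sigma> ((\<sigma> n)\<^sup>2)))"
        using elim by simp
      \<comment> \<open>The numerator is positive since \<open>\<sigma> n < 1\<close>, so the
        smaller count in the denominator gives the larger quotient.\<close>
      have "- ln (\<sigma> n) / ln (real n)
          \<le> - ln (\<sigma> n) / ln (real (counting_function \<sigma> ((\<sigma> n)\<^sup>2)))"
        using \<sigma> ln_pos ln_mono ln_less_zero[of "\<sigma> n"] by (intro divide_left_mono) auto
      also have "\<dots> = ln ((\<sigma> n)\<^sup>2) / (- 2 * ln (real (counting_function \<sigma> ((\<sigma> n)\<^sup>2))))"
        using \<sigma> by (simp add: ln_realpow)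
      finally show ?case
        by simp
    qed
  qed
  also have "\<dots> \<le> Limsup (at_right 0) ?f"
    by (rule Limsup_filterlim_ge[where f = ?f, OF lim])
  finally show ?thesis .
qed

end

section \<open>Compactness forces the singular values to tend to 0\<close>

lemma singular_values_decreasing_null_sequence:
  fixes T :: "'a::real_inner \<Rightarrow> 'b::real_inner"
  assumes "compact_operator T" "singular_values T \<sigma>"
  shows "decreasing_null_sequence \<sigma>"
proof -
  obtain u v where sys: "singular_system T u v \<sigma>"
    using assms by (auto simp: singular_values_def)
  then have pos: "\<And>n. 1 \<le> n \<Longrightarrow> 0 < \<sigma> n"
    and dec: "\<And>m n. 1 \<le> m \<Longrightarrow> m \<le> n \<Longrightarrow> \<sigma> n \<le> \<sigma> m"
    and Tu: "\<And>n. 1 \<le> n \<Longrightarrow> T (u n) = \<sigma> n *\<^sub>R v n"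
    and u: "\<And>n. 1 \<le> n \<Longrightarrow> u n \<bullet> u n = 1"
    and v: "\<And>m n. 1 \<le> m \<Longrightarrow> 1 \<le> n \<Longrightarrow> v m \<bullet> v n = (if m = n then 1 else 0)"
    by (auto simp: singular_system_def complete_orthonormal_system_def)
  have "bounded (u ` {1..})"
    using u by (intro boundedI[where B = 1]) (auto simp: norm_eq_sqrt_inner)
  then have comp: "compact (closure (T ` u ` {1..}))"
    using assms by (auto simp: compact_operator_def)
  \<comment> \<open>If all singular values were at least \<open>c\<close>, the images of the
    orthonormal vectors \<open>u n\<close> would keep mutual distance at least \<open>c\<close>, so
    no subsequence of them could converge.\<close>
  have small: "\<exists>n\<ge>1. \<sigma> n < c" if "0 < c" for c
  proof (rule ccontr)
    assume "\<not> (\<exists>n\<ge>1. \<sigma> n < c)"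
    then have ge: "c \<le> \<sigma> n" if "1 \<le> n" for n
      using that by (meson not_le)
    \<comment> \<open>The shift by \<open>Suc\<close> avoids the unconstrained index 0.\<close>
    have "\<forall>n. T (u (Suc n)) \<in> closure (T ` u ` {1..})"
      by (intro allI subsetD[OF closure_subset]) auto
    then obtain l r where r: "strict_mono r"
      and "((\<lambda>n. T (u (Suc n))) \<circ> r) \<longlonglongrightarrow> l"
      using comp unfolding compact_def by meson
    then have "Cauchy ((\<lambda>n. T (u (Suc n))) \<circ> r)"
      by (intro LIMSEQ_imp_Cauchy)
    then obtain M where M: "\<And>m n. M \<le> m \<Longrightarrow> M \<le> n \<Longrightarrow>
        dist (T (u (Suc (r m)))) (T (u (Suc (r n)))) < c"
      using metric_CauchyD[OF _ \<open>0 < c\<close>] unfolding comp_def by blast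
    define p q where "p = Suc (r M)" and "q = Suc (r (Suc M))"
    have pq: "1 \<le> p" "1 \<le> q" "p \<noteq> q"
      using r by (auto simp: p_def q_def strict_mono_eq)
    \<comment> \<open>Pythagoras: the cross terms vanish because \<open>v p\<close> and
      \<open>v q\<close> are orthogonal for distinct indices.\<close>
    have dist_eq: "(dist (T (u p)) (T (u q)))\<^sup>2 = (\<sigma> p)\<^sup>2 + (\<sigma> q)\<^sup>2"
      unfolding dist_norm power2_norm_eq_inner
      using pq by (simp add: Tu v inner_diff_left inner_diff_right power2_eq_square)
    have "c\<^sup>2 \<le> (\<sigma> p)\<^sup>2"
      using ge[of p] pq \<open>0 < c\<close> by (intro power_mono) auto
    then have "c\<^sup>2 \<le> (dist (T (u p)) (T (u q)))\<^sup>2"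
      unfolding dist_eq by (simp add: add_increasing2)
    then have "c \<le> dist (T (u p)) (T (u q))"
      by (rule power2_le_imp_le) simp
    with M[of M "Suc M"] show False
      by (simp add: p_def q_def)
  qed
  \<comment> \<open>By monotonicity one value below \<open>c\<close> keeps all later values below
    \<open>c\<close>.\<close>
  have "\<sigma> \<longlonglongrightarrow> 0"
  proof (rule LIMSEQ_I)
    fix c :: real assume "0 < c"
    then obtain N where "1 \<le> N" "\<sigma> N < c"
      using small by auto
    then have "norm (\<sigma> n - 0) < c" if "N \<le> n" for n
      using that pos[of n] dec[of N n] by simp
    then show "\<exists>N. \<forall>n\<ge>N. norm (\<sigma> n - 0) < c" by blast
  qed
  with pos dec show ?thesis
    by unfold_locales
qed

theorem theorem1:
  fixes T :: "'a::{real_inner, complete_space} \<Rightarrow> 'b::{real_inner, complete_space}"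
    and \<sigma> :: "nat \<Rightarrow> real"
  assumes "infinite_dimensional TYPE('a)"
    and "infinite_dimensional TYPE('b)"
    and "separable_space (euclidean :: 'a topology)"
    and "separable_space (euclidean :: 'b topology)"
    and "compact_operator T"
    and "inj T"
    and "singular_values T \<sigma>"
  defines "\<Phi> \<equiv> counting_function \<sigma>"
  defines "A \<equiv> Liminf (at_right 0) (\<lambda>\<epsilon>::real. ereal (ln \<epsilon> / (- 2 * ln (real (\<Phi> \<epsilon>)))))"
    and "B \<equiv> Limsup (at_right 0) (\<lambda>\<epsilon>::real. ereal (ln \<epsilon> / (- 2 * ln (real (\<Phi> \<epsilon>)))))"
  shows "illposedness_interval \<sigma> = {A..B} \<and> illposedness_lower \<sigma> = A \<and> illposedness_upper \<sigma> = B"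
proof -
  interpret decreasing_null_sequence \<sigma>
    using assms by (intro singular_values_decreasing_null_sequence)
  have "illposedness_lower \<sigma> = A"
    unfolding A_def \<Phi>_def using illposedness_lower_le illposedness_lower_ge by (rule antisym)
  moreover have "illposedness_upper \<sigma> = B"
    unfolding B_def \<Phi>_def using illposedness_upper_le illposedness_upper_ge by (rule antisym)
  ultimately show ?thesis
    by (simp add: illposedness_interval_def)
qed

end
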